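(* Let $f_{\mathrm{e}}$ be an NMS function on the edge set of an exchange graph and let $\alpha \in (0,1)$. Given an $\alpha$-approximation algorithm for the vertex selection problem $(\mathtt{P}_{\mathrm{v}})$, the following is an $\alpha$-approximation algorithm for the edge selection problem $(\mathtt{P}_{\mathrm{e}})$: (1) run the $\alpha$-approximation algorithm on $(\mathtt{P}_{\mathrm{v}})$ to produce a set $\tilde{\mathcal{V}} \subseteq \mathcal{V}_{\mathsf{x}}$; (2) return $\mathrm{edges}(\tilde{\mathcal{V}})$. In particular, if $\tilde{\mathcal{V}}$ is feasible for $(\mathtt{P}_{\mathrm{v}})$ and $f_{\mathrm{v}}(\tilde{\mathcal{V}}) \geq \alpha \cdot \mathrm{OPT}_{\mathrm{v}}$, then $\mathrm{edges}(\tilde{\mathcal{V}})$ is feasible for $(\mathtt{P}_{\mathrm{e}})$ and $f_{\mathrm{e}}\big(\mathrm{edges}(\tilde{\mathcal{V}})\big) \geq \alpha \cdot \mathrm{OPT}_{\mathrm{e}}$.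
   Context: An exchange graph is a finite simple undirected graph $\mathcal{G} = (\mathcal{V}_{\mathsf{x}}, \mathcal{E}_{\mathsf{x}})$ with vertex weights $w : \mathcal{V}_{\mathsf{x}} \to \mathbb{R}_{>0}$ (it also carries edge probabilities $p : \mathcal{E}_{\mathsf{x}} \to (0,1]$, not used here). For $\mathcal{V} \subseteq \mathcal{V}_{\mathsf{x}}$, $\mathrm{edges}(\mathcal{V})$ is the set of all edges in $\mathcal{E}_{\mathsf{x}}$ having at least one endpoint in $\mathcal{V}$. For $\mathcal{E} \subseteq \mathcal{E}_{\mathsf{x}}$, $c_w(\mathcal{E})$ is the minimum of $\sum_{v \in \mathcal{C}} w(v)$ over all vertex covers $\mathcal{C}$ of $\mathcal{E}$, i.e. sets of vertices such that every edge of $\mathcal{E}$ has at least one endpoint in $\mathcal{C}$. A set function $f : 2^{\mathcal{W}} \to \mathbb{R}_{\geq 0}$ on a finite set $\mathcal{W}$ is NMS if $f(\varnothing) = 0$ (normalized), $f(\mathcal{A}) \leq f(\mathcal{B})$ whenever $\mathcal{A} \subseteq \mathcal{B}$ (monotone), and $f(\mathcal{A}) + f(\mathcal{B}) \geq f(\mathcal{A} \cup \mathcal{B}) + f(\mathcal{A} \cap \mathcal{B})$ for all $\mathcal{A}, \mathcal{B} \subseteq \mathcal{W}$ (submodular). Fix a budget $b \geq 0$. Given $f_{\mathrm{e}} : 2^{\mathcal{E}_{\mathsf{x}}} \to \mathbb{R}_{\geq 0}$, define $f_{\mathrm{v}}(\mathcal{V}) = f_{\mathrm{e}}(\mathrm{edges}(\mathcal{V}))$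 for $\mathcal{V} \subseteq \mathcal{V}_{\mathsf{x}}$. Edge selection problem $(\mathtt{P}_{\mathrm{e}})$: maximize $f_{\mathrm{e}}(\mathcal{E})$ over $\mathcal{E} \subseteq \mathcal{E}_{\mathsf{x}}$ subject to $c_w(\mathcal{E}) \leq b$; its optimal value is $\mathrm{OPT}_{\mathrm{e}}$. Vertex selection problem $(\mathtt{P}_{\mathrm{v}})$: maximize $f_{\mathrm{v}}(\mathcal{V})$ over $\mathcal{V} \subseteq \mathcal{V}_{\mathsf{x}}$ subject to $\sum_{v \in \mathcal{V}} w(v) \leq b$; its optimal value is $\mathrm{OPT}_{\mathrm{v}}$. An $\alpha$-approximation algorithm for a maximization problem is an efficient (polynomial-time) algorithm that produces feasible solutions with value at least $\alpha \cdot \mathrm{OPT}$, where $\mathrm{OPT}$ is the optimal value. *)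

theory Defs
  imports Complex_Main "HOL-Computational_Algebra.Polynomial"
begin

section \<open>Exchange graphs and the two selection problems\<close>

record 'a exchange_graph =
  verts :: "'a set"
  edge_set :: "'a set set"
  weight :: "'a \<Rightarrow> real"
  prob :: "'a set \<Rightarrow> real"

definition is_exchange_graph :: "('a, 'm) exchange_graph_scheme \<Rightarrow> bool" where
  "is_exchange_graph G \<longleftrightarrow>
     finite (verts G) \<and>
     (\<forall>e \<in> edge_set G. e \<subseteq> verts G \<and> card e = 2) \<and>
     (\<forall>v \<in> verts G. 0 < weight G v) \<and>
     (\<forall>e \<in> edge_set G. 0 < prob G e \<and> prob G e \<le> 1)"

definition edges_at :: "('a, 'm) exchange_graph_scheme \<Rightarrow> 'a set \<Rightarrow> 'a set set" where
  "edges_at G V = {e \<in> edge_set G. e \<inter> V \<noteq> {}}"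

definition vertex_cover :: "('a, 'm) exchange_graph_scheme \<Rightarrow> 'a set set \<Rightarrow> 'a set \<Rightarrow> bool" where
  "vertex_cover G E C \<longleftrightarrow> C \<subseteq> verts G \<and> (\<forall>e \<in> E. e \<inter> C \<noteq> {})"

definition cover_cost :: "('a, 'm) exchange_graph_scheme \<Rightarrow> 'a set set \<Rightarrow> real" where
  "cover_cost G E = Min {sum (weight G) C | C. vertex_cover G E C}"

definition NMS :: "'b set \<Rightarrow> ('b set \<Rightarrow> real) \<Rightarrow> bool" where
  "NMS W f \<longleftrightarrow>
     (\<forall>A. A \<subseteq> W \<longrightarrow> 0 \<le> f A) \<and>
     f {} = 0 \<and>
     (\<forall>A B. A \<subseteq> B \<and> B \<subseteq> W \<longrightarrow> f A \<le> f B) \<and>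
     (\<forall>A B. A \<subseteq> W \<and> B \<subseteq> W \<longrightarrow> f A + f B \<ge> f (A \<union> B) + f (A \<inter> B))"

record 'a selection_data = "'a exchange_graph" +
  budget :: real
  fe :: "'a set set \<Rightarrow> real"

definition is_selection_data :: "'a selection_data \<Rightarrow> bool" where
  "is_selection_data I \<longleftrightarrow> is_exchange_graph I \<and> 0 \<le> budget I \<and> NMS (edge_set I) (fe I)"

definition fv :: "'a selection_data \<Rightarrow> 'a set \<Rightarrow> real" where
  "fv I V = fe I (edges_at I V)"

definition feasible_e :: "'a selection_data \<Rightarrow> 'a set set set" where
  "feasible_e I = {E. E \<subseteq> edge_set I \<and> cover_cost I E \<le> budget I}"

definition feasible_v :: "'a selection_data \<Rightarrow> 'a set set" where
  "feasible_v I = {V. V \<subseteq> verts I \<and> sum (weight I) V \<le> budget I}"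

text \<open>Both feasible sets are finite and nonempty (they contain the empty set), so the
  optimal values are genuine maxima.\<close>

definition opt_value :: "('s \<Rightarrow> real) \<Rightarrow> 's set \<Rightarrow> real" where
  "opt_value f F = Max (f ` F)"

definition OPT_e :: "'a selection_data \<Rightarrow> real" where
  "OPT_e I = opt_value (fe I) (feasible_e I)"

definition OPT_v :: "'a selection_data \<Rightarrow> real" where
  "OPT_v I = opt_value (fv I) (feasible_v I)"


section \<open>A machine model for efficient algorithms\<close>

text \<open>
  Algorithms are programs of a small imperative language executed on a random access machine
  over the reals. A program has an integer memory and a real memory, each organised in named
  two-dimensional arrays, and read-only access to the selection data, whose vertices are
  numbered \<open>0, \<dots>, n - 1\<close>. The set function is available as a value oracle.
  Every executed command and every test costs one time unit. Integer arithmetic is restricted to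
  addition and truncated subtraction, so that integers produced in time \<open>t\<close> have \<open>O(t)\<close> bits
  more than the input size and the constants of the program, and unit cost is reasonable. The only
  literal constants are natural numbers, there is no rounding, and real arithmetic is exact.
\<close>

type_synonym name = string

datatype nexp =
    NConst nat
  | NOrder
  | NCell name nexp nexp
  | NPlus nexp nexp
  | NMinus nexp nexp

datatype rexp =
    ROf_nat nexp
  | RBudget
  | RWeight nexp
  | RProb nexp nexp
  | RCell name nexp nexp
  | RPlus rexp rexp
  | RMinus rexp rexp
  | RTimes rexp rexp
  | RDivide rexp rexp

datatype bexp =
    BAdj nexp nexp
  | BNLess nexp nexp
  | BRLess rexp rexp
  | BNot bexp
  | BAnd bexp bexp

text \<open>\<open>Query a x i j\<close> stores in the real cell \<open>x[i, j]\<close> the value of the set function at the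
  edge set described by the integer array \<open>a\<close>.\<close>

datatype com =
    Skip
  | NAssign name nexp nexp nexp
  | RAssign name nexp nexp rexp
  | Query name name nexp nexp
  | Seq com com
  | If bexp com com
  | While bexp com

record state =
  nmem :: "name \<Rightarrow> nat \<Rightarrow> nat \<Rightarrow> nat"
  rmem :: "name \<Rightarrow> nat \<Rightarrow> nat \<Rightarrow> real"

definition init_state :: state where
  "init_state = \<lparr>nmem = (\<lambda>_ _ _. 0), rmem = (\<lambda>_ _ _. 0)\<rparr>"

definition upd :: "(name \<Rightarrow> nat \<Rightarrow> nat \<Rightarrow> 'v) \<Rightarrow> name \<Rightarrow> nat \<Rightarrow> nat \<Rightarrow> 'v \<Rightarrow> name \<Rightarrow> nat \<Rightarrow> nat \<Rightarrow> 'v" where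
  "upd m x i j v = m(x := (m x)(i := (m x i)(j := v)))"

text \<open>Vertex and edge sets are represented by characteristic arrays; the edge \<open>{i, j}\<close> with
  \<open>i < j\<close> is represented by the cell \<open>[i, j]\<close>.\<close>

definition vset_of :: "nat selection_data \<Rightarrow> state \<Rightarrow> name \<Rightarrow> nat set" where
  "vset_of I s a = {i \<in> verts I. nmem s a i 0 \<noteq> 0}"

definition eset_of :: "nat selection_data \<Rightarrow> state \<Rightarrow> name \<Rightarrow> nat set set" where
  "eset_of I s a = {{i, j} | i j. i < j \<and> {i, j} \<in> edge_set I \<and> nmem s a i j \<noteq> 0}"

fun nval :: "nat selection_data \<Rightarrow> state \<Rightarrow> nexp \<Rightarrow> nat" where
  "nval I s (NConst k) = k"
| "nval I s NOrder = card (verts I)"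
| "nval I s (NCell x e1 e2) = nmem s x (nval I s e1) (nval I s e2)"
| "nval I s (NPlus e1 e2) = nval I s e1 + nval I s e2"
| "nval I s (NMinus e1 e2) = nval I s e1 - nval I s e2"

text \<open>Weights and probabilities read as \<open>0\<close> outside the graph, so that a program learns nothing
  from the values of the underlying total functions there.\<close>

fun rval :: "nat selection_data \<Rightarrow> state \<Rightarrow> rexp \<Rightarrow> real" where
  "rval I s (ROf_nat e) = real (nval I s e)"
| "rval I s RBudget = budget I"
| "rval I s (RWeight e) = (let v = nval I s e in if v \<in> verts I then weight I v else 0)"
| "rval I s (RProb e1 e2) =
     (let e = {nval I s e1, nval I s e2} in if e \<in> edge_set I then prob I e else 0)"
| "rval I s (RCell x e1 e2) = rmem s x (nval I s e1) (nval I s e2)"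
| "rval I s (RPlus e1 e2) = rval I s e1 + rval I s e2"
| "rval I s (RMinus e1 e2) = rval I s e1 - rval I s e2"
| "rval I s (RTimes e1 e2) = rval I s e1 * rval I s e2"
| "rval I s (RDivide e1 e2) = rval I s e1 / rval I s e2"

fun bval :: "nat selection_data \<Rightarrow> state \<Rightarrow> bexp \<Rightarrow> bool" where
  "bval I s (BAdj e1 e2) \<longleftrightarrow> {nval I s e1, nval I s e2} \<in> edge_set I"
| "bval I s (BNLess e1 e2) \<longleftrightarrow> nval I s e1 < nval I s e2"
| "bval I s (BRLess e1 e2) \<longleftrightarrow> rval I s e1 < rval I s e2"
| "bval I s (BNot b) \<longleftrightarrow> \<not> bval I s b"
| "bval I s (BAnd b1 b2) \<longleftrightarrow> bval I s b1 \<and> bval I s b2"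

text \<open>\<open>exec I c s t s'\<close>: on selection data \<open>I\<close>, the program \<open>c\<close> started in \<open>s\<close> halts in \<open>s'\<close>
  after exactly \<open>t\<close> time units.\<close>

inductive exec :: "nat selection_data \<Rightarrow> com \<Rightarrow> state \<Rightarrow> nat \<Rightarrow> state \<Rightarrow> bool" for I where
  Skip: "exec I Skip s 1 s"
| NAssign: "exec I (NAssign x e1 e2 e) s 1
    (s\<lparr>nmem := upd (nmem s) x (nval I s e1) (nval I s e2) (nval I s e)\<rparr>)"
| RAssign: "exec I (RAssign x e1 e2 e) s 1
    (s\<lparr>rmem := upd (rmem s) x (nval I s e1) (nval I s e2) (rval I s e)\<rparr>)"
| Query: "exec I (Query a x e1 e2) s 1
    (s\<lparr>rmem := upd (rmem s) x (nval I s e1) (nval I s e2) (fe I (eset_of I s a))\<rparr>)"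
| Seq: "exec I c1 s t1 s1 \<Longrightarrow> exec I c2 s1 t2 s2 \<Longrightarrow> exec I (Seq c1 c2) s (t1 + t2) s2"
| IfTrue: "bval I s b \<Longrightarrow> exec I c1 s t s' \<Longrightarrow> exec I (If b c1 c2) s (t + 1) s'"
| IfFalse: "\<not> bval I s b \<Longrightarrow> exec I c2 s t s' \<Longrightarrow> exec I (If b c1 c2) s (t + 1) s'"
| WhileFalse: "\<not> bval I s b \<Longrightarrow> exec I (While b c) s 1 s"
| WhileTrue: "bval I s b \<Longrightarrow> exec I c s t1 s1 \<Longrightarrow> exec I (While b c) s1 t2 s2 \<Longrightarrow>
    exec I (While b c) s (t1 + t2 + 1) s2"


section \<open>Approximation algorithms\<close>

definition numbered_selection_data :: "nat selection_data \<Rightarrow> bool" where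
  "numbered_selection_data I \<longleftrightarrow> is_selection_data I \<and> verts I = {..<card (verts I)}"

definition input_size :: "nat selection_data \<Rightarrow> nat" where
  "input_size I = card (verts I) + card (edge_set I)"

text \<open>A maximization problem on a class \<open>K\<close> of inputs is given by the feasible solutions and the
  objective function of each input; \<open>out\<close> reads off the solution from the final state.\<close>

definition approximation_algorithm ::
  "nat selection_data set \<Rightarrow> (nat selection_data \<Rightarrow> 's set) \<Rightarrow> (nat selection_data \<Rightarrow> 's \<Rightarrow> real) \<Rightarrow>
   (nat selection_data \<Rightarrow> state \<Rightarrow> 's) \<Rightarrow> real \<Rightarrow> com \<Rightarrow> bool" where
  "approximation_algorithm K feas obj out \<alpha> c \<longleftrightarrow>
     (\<exists>q :: nat poly. \<forall>I \<in> K. \<exists>t s.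
        exec I c init_state t s \<and> t \<le> poly q (input_size I) \<and>
        out I s \<in> feas I \<and> obj I (out I s) \<ge> \<alpha> * opt_value (obj I) (feas I))"

definition vertex_output :: "nat selection_data \<Rightarrow> state \<Rightarrow> nat set" where
  "vertex_output I s = vset_of I s ''V''"

definition edge_output :: "nat selection_data \<Rightarrow> state \<Rightarrow> nat set set" where
  "edge_output I s = eset_of I s ''E''"

definition approx_alg_v :: "nat selection_data set \<Rightarrow> real \<Rightarrow> com \<Rightarrow> bool" where
  "approx_alg_v K \<alpha> c \<longleftrightarrow> approximation_algorithm K feasible_v fv vertex_output \<alpha> c"

definition approx_alg_e :: "nat selection_data set \<Rightarrow> real \<Rightarrow> com \<Rightarrow> bool" where
  "approx_alg_e K \<alpha> c \<longleftrightarrow> approximation_algorithm K feasible_e fe edge_output \<alpha> c"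

text \<open>A program for the step ``return \<open>edges(V)\<close>'', where \<open>V\<close> is the vertex set left behind by an
  arbitrary preceding computation.\<close>

definition returns_edges :: "com \<Rightarrow> bool" where
  "returns_edges R \<longleftrightarrow>
     (\<forall>I s. numbered_selection_data I \<longrightarrow>
        (\<exists>t s'. exec I R s t s' \<and> edge_output I s' = edges_at I (vertex_output I s)))"

end

theory Submission
  imports Defs
begin

text \<open>
  A set \<open>V\<close> covers \<open>edges(V)\<close>, so a feasible vertex set yields a feasible edge set of the same value.
  Conversely, a minimum-weight cover \<open>C\<close> of a feasible edge set \<open>E\<close> is a feasible vertex set with
  \<open>E \<subseteq> edges(C)\<close>, so by monotonicity the optimum of the edge problem is at most that of the vertex
  problem. For the algorithm, it remains to compute \<open>edges(V)\<close> in quadratic time.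
\<close>

section \<open>Comparison of the optimal values\<close>

lemma finite_edge_set:
  assumes "is_exchange_graph G"
  shows "finite (edge_set G)"
proof (rule finite_subset)
  show "edge_set G \<subseteq> Pow (verts G)" using assms by (auto simp: is_exchange_graph_def)
  show "finite (Pow (verts G))" using assms by (simp add: is_exchange_graph_def)
qed

text \<open>\<open>Min\<close> has its intended meaning only on finite nonempty sets. Covers are
  subsets of the finite \<open>verts G\<close>, which settles finiteness.\<close>

lemma finite_cover_weights:
  assumes "is_exchange_graph G"
  shows "finite {sum (weight G) C | C. vertex_cover G E C}"
proof (rule finite_subset)
  show "{sum (weight G) C | C. vertex_cover G E C} \<subseteq> sum (weight G) ` Pow (verts G)"
    by (auto simp: vertex_cover_def)
  show "finite (sum (weight G) ` Pow (verts G))"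
    using assms by (simp add: is_exchange_graph_def)
qed

lemma cover_cost_le:
  assumes "is_exchange_graph G" "vertex_cover G E C"
  shows "cover_cost G E \<le> sum (weight G) C"
  unfolding cover_cost_def
  by (rule Min_le[OF finite_cover_weights[OF assms(1)]]) (use assms(2) in blast)

text \<open>The set of all vertices is a cover, because every edge is a two-element subset of
  \<open>verts G\<close>; hence the minimum is taken over a nonempty finite set.\<close>

lemma cover_cost_attained:
  assumes G: "is_exchange_graph G" and E: "E \<subseteq> edge_set G"
  obtains C where "vertex_cover G E C" "sum (weight G) C = cover_cost G E"
proof -
  have "e \<inter> verts G \<noteq> {}" if "e \<in> E" for e
  proof -
    have "e \<subseteq> verts G" "card e = 2" using G E that by (auto simp: is_exchange_graph_def)
    then show ?thesis by (auto simp: Int_absorb2)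
  qed
  then have "vertex_cover G E (verts G)" by (simp add: vertex_cover_def)
  then have "{sum (weight G) C | C. vertex_cover G E C} \<noteq> {}" by blast
  from Min_in[OF finite_cover_weights[OF G] this] that show thesis
    unfolding cover_cost_def by force
qed

lemma edges_at_feasible:
  assumes "is_exchange_graph I" "V \<in> feasible_v I"
  shows "edges_at I V \<in> feasible_e I"
proof -
  have "vertex_cover I (edges_at I V) V"
    using assms(2) by (auto simp: vertex_cover_def edges_at_def feasible_v_def)
  from cover_cost_le[OF assms(1) this] show ?thesis
    using assms(2) by (auto simp: feasible_e_def feasible_v_def edges_at_def)
qed

lemma OPT_e_le_OPT_v:
  assumes "is_selection_data I"
  shows "OPT_e I \<le> OPT_v I"
proof -
  have G: "is_exchange_graph I" and b: "0 \<le> budget I" and f: "NMS (edge_set I) (fe I)"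
    using assms by (auto simp: is_selection_data_def)
  have finv: "finite (feasible_v I)"
    by (rule finite_subset[of _ "Pow (verts I)"])
      (use G in \<open>auto simp: feasible_v_def is_exchange_graph_def\<close>)
  have fine: "finite (feasible_e I)"
    by (rule finite_subset[of _ "Pow (edge_set I)"])
      (use finite_edge_set[OF G] in \<open>auto simp: feasible_e_def\<close>)
  \<comment> \<open>The empty vertex set fits any nonnegative budget, and its image under
    \<open>edges_at I\<close> shows that \<open>OPT_e I\<close> is a maximum over a nonempty
    set.\<close>
  have "{} \<in> feasible_v I" using b by (simp add: feasible_v_def)
  from edges_at_feasible[OF G this] have ne: "feasible_e I \<noteq> {}" by blast
  have "fe I E \<le> OPT_v I" if E: "E \<in> feasible_e I" for E
  proof -
    have sub: "E \<subseteq> edge_set I" using E by (simp add: feasible_e_def)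
    from cover_cost_attained[OF G sub] obtain C
      where C: "vertex_cover I E C" and w: "sum (weight I) C = cover_cost I E" .
    have CF: "C \<in> feasible_v I"
      using C w E by (simp add: feasible_v_def feasible_e_def vertex_cover_def)
    have "E \<subseteq> edges_at I C" "edges_at I C \<subseteq> edge_set I"
      using C sub by (auto simp: edges_at_def vertex_cover_def)
    then have "fe I E \<le> fv I C" using f by (simp add: NMS_def fv_def)
    also have "\<dots> \<le> OPT_v I"
      unfolding OPT_v_def opt_value_def using finv CF by (intro Max_ge) auto
    finally show ?thesis .
  qed
  with fine ne show ?thesis
    by (simp add: OPT_e_def opt_value_def)
qed

text \<open>Since \<alpha> is positive, \<alpha> * \<open>OPT_e I\<close> \<le> \<alpha> *
  \<open>OPT_v I\<close> \<le> \<open>fv I V\<close>, and the last value is that of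
  \<open>edges_at I V\<close> by definition of \<open>fv\<close>.\<close>

lemma edges_at_approximation:
  assumes "0 < \<alpha>" "is_selection_data I" "V \<in> feasible_v I" "fv I V \<ge> \<alpha> * OPT_v I"
  shows "edges_at I V \<in> feasible_e I" "fe I (edges_at I V) \<ge> \<alpha> * OPT_e I"
proof -
  show "edges_at I V \<in> feasible_e I"
    using edges_at_feasible assms(2,3) by (auto simp: is_selection_data_def)
  have "\<alpha> * OPT_e I \<le> \<alpha> * OPT_v I"
    using OPT_e_le_OPT_v[OF assms(2)] assms(1) by simp
  also note assms(4)
  finally show "fe I (edges_at I V) \<ge> \<alpha> * OPT_e I" by (simp add: fv_def)
qed

section \<open>Computing the incident edges\<close>

text \<open>Memory consists of arrays only, so cell [0, 0] plays the role of a scalar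
  variable.\<close>

abbreviation counter :: "name \<Rightarrow> nexp" where
  "counter x \<equiv> NCell x (NConst 0) (NConst 0)"

text \<open>The counter is reset explicitly because the loop may start in a memory left behind by
  another program.\<close>

definition for_vertices :: "name \<Rightarrow> com \<Rightarrow> com" where
  "for_vertices x c =
     Seq (NAssign x (NConst 0) (NConst 0) (NConst 0))
       (While (BNLess (counter x) NOrder)
         (Seq c (NAssign x (NConst 0) (NConst 0) (NPlus (counter x) (NConst 1)))))"

text \<open>An invariant rule with exact running time. Each round costs \<open>t + 2\<close>: the
  body, the test and the increment. The final 2 pays for the initial reset and the failing last
  test.\<close>

lemma exec_for_vertices:
  assumes init: "P 0 (s\<lparr>nmem := upd (nmem s) x 0 0 0\<rparr>)"
    and cnt: "\<And>k s. P k s \<Longrightarrow> nmem s x 0 0 = k"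
    and step: "\<And>k s. P k s \<Longrightarrow> k < card (verts I) \<Longrightarrow>
      \<exists>s'. exec I c s t s' \<and> nmem s' x 0 0 = k \<and>
        P (Suc k) (s'\<lparr>nmem := upd (nmem s') x 0 0 (Suc k)\<rparr>)"
  shows "\<exists>s'. exec I (for_vertices x c) s (card (verts I) * (t + 2) + 2) s' \<and> P (card (verts I)) s'"
proof -
  let ?n = "card (verts I)"
  let ?inc = "NAssign x (NConst 0) (NConst 0) (NPlus (counter x) (NConst 1))"
  let ?W = "While (BNLess (counter x) NOrder) (Seq c ?inc)"
  \<comment> \<open>Induction on the number \<open>d\<close> of rounds still to be run, from an
    arbitrary intermediate state.\<close>
  have loop: "\<exists>s'. exec I ?W s (d * (t + 2) + 1) s' \<and> P ?n s'" if "P k s" "k + d = ?n" for k d s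
    using that
  proof (induction d arbitrary: k s)
    case 0
    then have "exec I ?W s 1 s" by (intro exec.WhileFalse) (simp add: cnt)
    with 0 show ?case by auto
  next
    case (Suc d)
    then obtain s1 where s1: "exec I c s t s1" "nmem s1 x 0 0 = k"
        "P (Suc k) (s1\<lparr>nmem := upd (nmem s1) x 0 0 (Suc k)\<rparr>)"
      using step[of k s] by auto
    from Suc.IH[OF s1(3)] Suc.prems(2) obtain s2 where
      s2: "exec I ?W (s1\<lparr>nmem := upd (nmem s1) x 0 0 (Suc k)\<rparr>) (d * (t + 2) + 1) s2" "P ?n s2"
      by auto
    have "exec I ?inc s1 1 (s1\<lparr>nmem := upd (nmem s1) x 0 0 (Suc k)\<rparr>)"
      using exec.NAssign[of I x "NConst 0" "NConst 0" "NPlus (counter x) (NConst 1)" s1] s1(2)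
      by simp
    from exec.Seq[OF s1(1) this] s2(1) Suc.prems
    have "exec I ?W s (t + 1 + (d * (t + 2) + 1) + 1) s2"
      by (intro exec.WhileTrue) (simp_all add: cnt)
    moreover have "t + 1 + (d * (t + 2) + 1) + 1 = Suc d * (t + 2) + 1" by simp
    ultimately show ?case using s2(2) by metis
  qed
  from loop[OF init, of ?n] obtain s' where
    s': "exec I ?W (s\<lparr>nmem := upd (nmem s) x 0 0 0\<rparr>) (?n * (t + 2) + 1) s'" "P ?n s'" by auto
  have "exec I (NAssign x (NConst 0) (NConst 0) (NConst 0)) s 1 (s\<lparr>nmem := upd (nmem s) x 0 0 0\<rparr>)"
    using exec.NAssign[of I x "NConst 0" "NConst 0" "NConst 0" s] by simp
  from exec.Seq[OF this s'(1)] s'(2) show ?thesis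
    by (auto simp: for_vertices_def)
qed

text \<open>Every pair is marked without testing adjacency, since \<^const>\<open>eset_of\<close> ignores the cells that
  do not belong to an edge; the sum of the two entries is nonzero iff one of them is.\<close>

definition incident_edges_com :: com where
  "incident_edges_com =
     for_vertices ''i'' (for_vertices ''j''
       (NAssign ''E'' (counter ''i'') (counter ''j'')
         (NPlus (NCell ''V'' (counter ''i'') (NConst 0)) (NCell ''V'' (counter ''j'') (NConst 0)))))"

text \<open>The loop rule is applied twice: a row costs \<open>n * 3 + 2\<close>, and the outer loop
  adds 2 per row. All cells of \<open>E\<close> with both indices below \<open>n\<close> are
  overwritten, so stale entries do no harm.\<close>

lemma exec_incident_edges_com:
  defines "T \<equiv> \<lambda>n :: nat. n * (n * 3 + 4) + 2"
  assumes I: "numbered_selection_data I"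
  shows "\<exists>s'. exec I incident_edges_com s (T (card (verts I))) s' \<and>
    edge_output I s' = edges_at I (vertex_output I s)"
proof -
  define n where "n = card (verts I)"
  define v where "v = nmem s ''V''"
  let ?body = "NAssign ''E'' (counter ''i'') (counter ''j'')
    (NPlus (NCell ''V'' (counter ''i'') (NConst 0)) (NCell ''V'' (counter ''j'') (NConst 0)))"
  \<comment> \<open>\<open>P\<close> is the outer invariant: rows below \<open>k\<close> are filled
    and \<open>V\<close> still has its initial contents \<open>v\<close>. \<open>Q\<close> adds that
    row \<open>k\<close> is filled up to column \<open>l\<close>.\<close>
  define P where "P k r \<longleftrightarrow> nmem r ''V'' = v \<and> nmem r ''i'' 0 0 = k \<and>
    (\<forall>a<k. \<forall>b<n. nmem r ''E'' a b = v a 0 + v b 0)" for k and r :: state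
  define Q where "Q k l r \<longleftrightarrow> P k r \<and> nmem r ''j'' 0 0 = l \<and>
    (\<forall>b<l. nmem r ''E'' k b = v k 0 + v b 0)" for k l and r :: state
  have inner: "\<exists>r'. exec I (for_vertices ''j'' ?body) r (n * (1 + 2) + 2) r' \<and> Q k n r'"
    if "P k r" for k r
    unfolding n_def
  proof (rule exec_for_vertices)
    show "Q k 0 (r\<lparr>nmem := upd (nmem r) ''j'' 0 0 0\<rparr>)"
      using that by (simp add: P_def Q_def upd_def)
  next
    fix l r assume "Q k l r"
    then show "nmem r ''j'' 0 0 = l" by (simp add: Q_def)
  next
    fix l r assume Q: "Q k l r"
    let ?r = "r\<lparr>nmem := upd (nmem r) ''E'' k l (v k 0 + v l 0)\<rparr>"
    have "exec I ?body r 1 ?r"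
      using exec.NAssign[of I "''E''" "counter ''i''" "counter ''j''"
        "NPlus (NCell ''V'' (counter ''i'') (NConst 0)) (NCell ''V'' (counter ''j'') (NConst 0))" r] Q
      by (simp add: P_def Q_def)
    moreover have "nmem ?r ''j'' 0 0 = l"
      "Q k (Suc l) (?r\<lparr>nmem := upd (nmem ?r) ''j'' 0 0 (Suc l)\<rparr>)"
      using Q by (auto simp: P_def Q_def upd_def less_Suc_eq)
    ultimately show "\<exists>r'. exec I ?body r 1 r' \<and> nmem r' ''j'' 0 0 = l \<and>
        Q k (Suc l) (r'\<lparr>nmem := upd (nmem r') ''j'' 0 0 (Suc l)\<rparr>)"
      by blast
  qed
  have "\<exists>s'. exec I incident_edges_com s (n * ((n * (1 + 2) + 2) + 2) + 2) s' \<and> P n s'"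
    unfolding incident_edges_com_def n_def
  proof (rule exec_for_vertices)
    show "P 0 (s\<lparr>nmem := upd (nmem s) ''i'' 0 0 0\<rparr>)"
      by (simp add: P_def upd_def v_def)
  next
    fix k r assume "P k r"
    then show "nmem r ''i'' 0 0 = k" by (simp add: P_def)
  next
    fix k r assume "P k r"
    from inner[OF this] obtain r'
      where r': "exec I (for_vertices ''j'' ?body) r (n * (1 + 2) + 2) r'" "Q k n r'" by blast
    from r'(2) have "nmem r' ''i'' 0 0 = k"
      "P (Suc k) (r'\<lparr>nmem := upd (nmem r') ''i'' 0 0 (Suc k)\<rparr>)"
      by (auto simp: P_def Q_def upd_def less_Suc_eq)
    with r'(1) show "\<exists>r'. exec I (for_vertices ''j'' ?body) r (card (verts I) * (1 + 2) + 2) r' \<and>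
        nmem r' ''i'' 0 0 = k \<and> P (Suc k) (r'\<lparr>nmem := upd (nmem r') ''i'' 0 0 (Suc k)\<rparr>)"
      unfolding n_def by blast
  qed
  moreover have "n * ((n * (1 + 2) + 2) + 2) + 2 = T n" by (simp add: T_def algebra_simps)
  ultimately obtain s' where ex: "exec I incident_edges_com s (T n) s'" and P: "P n s'"
    by metis
  have G: "is_exchange_graph I" and V: "verts I = {..<n}"
    using I by (auto simp: numbered_selection_data_def is_selection_data_def n_def)
  have mark: "nmem s' ''E'' a b \<noteq> 0 \<longleftrightarrow> {a, b} \<inter> vertex_output I s \<noteq> {}"
    if "{a, b} \<in> edge_set I" for a b
  proof -
    \<comment> \<open>Endpoints of an edge are vertices, hence lie in the index range filled by the
      loops.\<close>
    have "{a, b} \<subseteq> verts I" using G that unfolding is_exchange_graph_def by blast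
    then have "a < n" "b < n" by (auto simp: V)
    with P show ?thesis by (auto simp: P_def vertex_output_def vset_of_def V v_def)
  qed
  have "e \<in> edge_output I s'" if e: "e \<in> edges_at I (vertex_output I s)" for e
  proof -
    have "e \<in> edge_set I" using e by (simp add: edges_at_def)
    moreover from this have "card e = 2" using G by (simp add: is_exchange_graph_def)
    \<comment> \<open>\<open>eset_of\<close> reads an edge only from the cell whose first index is
      the smaller endpoint.\<close>
    then obtain a b where "e = {a, b}" "a < b"
      by (metis card_2_iff insert_commute linorder_neqE_nat)
    ultimately show ?thesis
      using e mark[of a b] by (auto simp: edge_output_def eset_of_def edges_at_def)
  qed
  moreover have "e \<in> edges_at I (vertex_output I s)" if "e \<in> edge_output I s'" for e
    using that mark by (auto simp: edge_output_def eset_of_def edges_at_def)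
  ultimately have "edge_output I s' = edges_at I (vertex_output I s)" by blast
  with ex show ?thesis by (auto simp: n_def)
qed

text \<open>The second step adds a quadratic running time to a polynomial one, and the guarantee
  carries over instance by instance.\<close>

lemma approx_alg_e_Seq_incident_edges_com:
  assumes "0 < \<alpha>" and K: "\<forall>I \<in> K. numbered_selection_data I" and A: "approx_alg_v K \<alpha> A"
  shows "approx_alg_e K \<alpha> (Seq A incident_edges_com)"
proof -
  from A obtain q :: "nat poly" where q: "\<And>I. I \<in> K \<Longrightarrow> \<exists>t s.
      exec I A init_state t s \<and> t \<le> poly q (input_size I) \<and> vertex_output I s \<in> feasible_v I \<and>
      fv I (vertex_output I s) \<ge> \<alpha> * OPT_v I"
    by (auto simp: approx_alg_v_def approximation_algorithm_def OPT_v_def)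
  show ?thesis
    unfolding approx_alg_e_def approximation_algorithm_def
  \<comment> \<open>The added polynomial 2 + 4x + 3x^2 is the exact cost
    \<open>n * (n * 3 + 4) + 2\<close>, evaluated at the input size instead of the smaller or equal
    \<open>n\<close>.\<close>
  proof (intro exI[of _ "q + [:2, 4, 3:]"] ballI)
    fix I assume "I \<in> K"
    then have num: "numbered_selection_data I" and sel: "is_selection_data I"
      using K by (auto simp: numbered_selection_data_def)
    from q[OF \<open>I \<in> K\<close>] obtain t s where s: "exec I A init_state t s"
      "t \<le> poly q (input_size I)" "vertex_output I s \<in> feasible_v I"
      "fv I (vertex_output I s) \<ge> \<alpha> * OPT_v I" by blast
    let ?n = "card (verts I)"
    from exec_incident_edges_com[OF num, of s] obtain s' where
      s': "exec I incident_edges_com s (?n * (?n * 3 + 4) + 2) s'"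
        "edge_output I s' = edges_at I (vertex_output I s)" by blast
    have "?n \<le> input_size I" by (simp add: input_size_def)
    then have "?n * (?n * 3 + 4) \<le> input_size I * (input_size I * 3 + 4)"
      by (intro mult_le_mono) auto
    with s(2) have "t + (?n * (?n * 3 + 4) + 2) \<le> poly (q + [:2, 4, 3:]) (input_size I)"
      by (simp add: algebra_simps)
    with exec.Seq[OF s(1) s'(1)] edges_at_approximation[OF assms(1) sel s(3,4)]
    show "\<exists>t s. exec I (Seq A incident_edges_com) init_state t s \<and>
        t \<le> poly (q + [:2, 4, 3:]) (input_size I) \<and> edge_output I s \<in> feasible_e I \<and>
        fe I (edge_output I s) \<ge> \<alpha> * opt_value (fe I) (feasible_e I)"
      unfolding s'(2)[symmetric] OPT_e_def by blast
  qed
qed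

theorem theorem2:
  fixes \<alpha> :: real
  assumes "0 < \<alpha>" and "\<alpha> < 1"
  shows
    "(\<exists>R. returns_edges R \<and>
        (\<forall>K A. (\<forall>I \<in> K. numbered_selection_data I) \<longrightarrow>
           approx_alg_v K \<alpha> A \<longrightarrow> approx_alg_e K \<alpha> (Seq A R))) \<and>
     (\<forall>(I :: 'a selection_data) V.
        is_selection_data I \<longrightarrow> V \<in> feasible_v I \<longrightarrow> fv I V \<ge> \<alpha> * OPT_v I \<longrightarrow>
          edges_at I V \<in> feasible_e I \<and> fe I (edges_at I V) \<ge> \<alpha> * OPT_e I)"
proof (intro conjI exI[of _ incident_edges_com] allI impI)
  \<comment> \<open>The witness for \<open>R\<close> is fixed before \<open>K\<close> and
    \<open>A\<close>, so one program completes every vertex algorithm.\<close>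
  show "returns_edges incident_edges_com"
    using exec_incident_edges_com unfolding returns_edges_def by blast
qed (use assms in \<open>blast intro: approx_alg_e_Seq_incident_edges_com edges_at_approximation\<close>)+

end
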